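(* Let $S = \langle r_1, \ldots, r_k\rangle$ be a numerical semigroup and let $w = (w_1, \ldots, w_k) \in \mathbb{Q}^k$ be a weight vector, with the generators ordered so that $r_1 \le_w r_2 \le_w \cdots \le_w r_k$ (that is, $w_1/r_1 \ge w_2/r_2 \ge \cdots \ge w_k/r_k$). Let $R = \max(r_1, \ldots, r_k)$. (a) For all $n \in S$ with $n > R^2$, the maximal weighted length function $\mathsf{M}_w : S \to \mathbb{Q}$ satisfies $\mathsf{M}_w(n) = \mathsf{M}_w(n - r_1) + w_1$. (b) For all $n \in S$ with $n > R^2$, the minimal weighted length function $\mathsf{m}_w : S \to \mathbb{Q}$ satisfies $\mathsf{m}_w(n) = \mathsf{m}_w(n - r_k) + w_k$.
   Context: A numerical semigroup $S = \langle r_1,\ldots,r_k\rangle$ is the additive subsemigroup $\{z_1 r_1 + \cdots + z_k r_k : z_i \in \mathbb{Z}_{\ge 0}\}$ of $\mathbb{Z}_{\ge 0}$ generated by positive integers $r_1,\ldots,r_k$; it is not required to have finite complement in $\mathbb{Z}_{\ge 0}$. The set of factorizations of $n \in S$ is $\mathsf{Z}(n) = \{z \in \mathbb{Z}_{\ge 0}^k : n = z_1 r_1 + \cdots + z_k r_k\}$. For a weight vector $w \in \mathbb{Q}^k$, the weighted length of $z$ is $|z|_w = w_1 z_1 + \cdots + w_k z_k$, and the weighted length set of $n$ is $\mathsf{L}_{S,w}(n) = \{|z|_w : z \in \mathsf{Z}(n)\}$. For $n \in S$, $\mathsf{M}_w(n) = \max \mathsf{L}_{S,w}(n)$ and $\mathsf{m}_w(n)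 = \min \mathsf{L}_{S,w}(n)$. The $w$-ordering is defined by $r_i \le_w r_j$ whenever $w_i/r_i \ge w_j/r_j$. *)

theory Defs
  imports Complex_Main
begin

text \<open>
  The generators are a list \<open>r\<close> of positive integers and the weight vector is a rational list \<open>w\<close>
  of the same length \<open>k\<close>; vectors in \<open>\<int>\<^sub>\<ge>\<^sub>0\<^sup>k\<close> are natural-number lists of length \<open>k\<close>.
  Indices run over \<open>0, \<dots>, k - 1\<close>. The list \<open>r\<close> may be redundant, and its gcd may exceed 1.
\<close>

definition num_semigroup :: "nat list \<Rightarrow> nat set" where
  "num_semigroup r = {\<Sum>i<length r. z ! i * r ! i | z :: nat list. length z = length r}"

definition factorizations :: "nat list \<Rightarrow> nat \<Rightarrow> nat list set" where
  "factorizations r n = {z. length z = length r \<and> n = (\<Sum>i<length r. z ! i * r ! i)}"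

definition weighted_length :: "rat list \<Rightarrow> nat list \<Rightarrow> rat" where
  "weighted_length w z = (\<Sum>i<length w. w ! i * of_nat (z ! i))"

definition length_set :: "nat list \<Rightarrow> rat list \<Rightarrow> nat \<Rightarrow> rat set" where
  "length_set r w n = weighted_length w ` factorizations r n"

text \<open>
  \<open>Max\<close> and \<open>Min\<close> are meaningful only on finite nonempty sets, so the following two functions
  describe the maximal and minimal weighted length only for \<open>n \<in> num_semigroup r\<close> with all
  generators positive; see \<open>finite_length_set\<close> and \<open>length_set_nonempty_iff\<close> below.
\<close>

definition max_length :: "nat list \<Rightarrow> rat list \<Rightarrow> nat \<Rightarrow> rat" where
  "max_length r w n = Max (length_set r w n)"

definition min_length :: "nat list \<Rightarrow> rat list \<Rightarrow> nat \<Rightarrow> rat" where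
  "min_length r w n = Min (length_set r w n)"

text \<open>
  The \<open>w\<close>-ordering of generators, as a relation on indices (equal generators may carry
  different weights). The inequality is reversed: smaller means larger weight per unit.
\<close>

definition w_le :: "nat list \<Rightarrow> rat list \<Rightarrow> nat \<Rightarrow> nat \<Rightarrow> bool" where
  "w_le r w i j \<longleftrightarrow> w ! i / of_nat (r ! i) \<ge> w ! j / of_nat (r ! j)"

lemma length_set_nonempty_iff: "length_set r w n \<noteq> {} \<longleftrightarrow> n \<in> num_semigroup r"
  by (auto simp: length_set_def factorizations_def num_semigroup_def)

lemma finite_length_set:
  assumes "\<forall>x\<in>set r. x > 0"
  shows "finite (length_set r w n)"
proof -
  have "z ! i \<le> n" if "z \<in> factorizations r n" "i < length r" for z i
  proof -
    have "z ! i \<le> z ! i * r ! i"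
      using assms that(2) by (simp add: Suc_leI)
    also have "\<dots> \<le> (\<Sum>i<length r. z ! i * r ! i)"
      using that(2) by (intro member_le_sum) auto
    also have "\<dots> = n"
      using that(1) by (simp add: factorizations_def)
    finally show ?thesis .
  qed
  then have "factorizations r n \<subseteq> {z. set z \<subseteq> {..n} \<and> length z = length r}"
    by (fastforce simp: factorizations_def in_set_conv_nth)
  moreover have "finite {z. set z \<subseteq> {..n} \<and> length z = length r}"
    by (rule finite_lists_length_eq) simp
  ultimately have "finite (factorizations r n)"
    by (rule finite_subset)
  then show ?thesis
    by (simp add: length_set_def)
qed

end

theory Submission
  imports Defs
begin

text \<open>
  The generator \<open>r ! p\<close> with the largest weight per unit is the most profitable one, so a
  factorization of maximal weighted length should use it whenever it can. It can as soon as
  \<open>n > R\<^sup>2\<close>: a factorization of such an \<open>n\<close> has more than \<open>R \<ge> r ! p\<close> summands, as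
  none of them exceeds \<open>R\<close>, and among any \<open>m = r ! p\<close> integers some nonempty subcollection
  has a sum divisible by \<open>m\<close>
  (\<open>nonempty_segment_sum_dvd\<close>). Trading that subcollection for copies of \<open>r ! p\<close> of the same
  total gives a factorization of the same \<open>n\<close> which uses \<open>r ! p\<close> and whose weighted length is
  no smaller (\<open>exchange_for_best_generator\<close>).

  Adding one copy of \<open>r ! p\<close> maps the factorizations of \<open>n - r ! p\<close> onto those factorizations of
  \<open>n\<close> that use \<open>r ! p\<close>, and raises the weighted length by \<open>w ! p\<close>. As a maximum over the
  latter is a maximum over all of them, the recursion for the maximum follows
  (\<open>max_length_recursion\<close>). Negating all weights exchanges maxima with minima and reverses the
  \<open>w\<close>-ordering, which reduces the recursion for the minimum to the one for the maximum.
\<close>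

section \<open>Subcollections with a divisible sum\<close>

text \<open>
  Two of the \<open>m + 1\<close> prefix sums of length at most \<open>m\<close> agree modulo \<open>m\<close>; the segment between
  them is the one wanted.
\<close>

lemma nonempty_segment_sum_dvd:
  fixes g :: "'a \<Rightarrow> nat"
  assumes "m > 0" "length xs \<ge> m"
  shows "\<exists>us ys vs. xs = us @ ys @ vs \<and> ys \<noteq> [] \<and> m dvd sum_list (map g ys)"
proof -
  let ?s = "\<lambda>j. sum_list (map g (take j xs))"
  have "card ((\<lambda>j. ?s j mod m) ` {..m}) \<le> card {..<m}"
    using assms by (intro card_mono) auto
  then have "\<not> inj_on (\<lambda>j. ?s j mod m) {..m}"
    by (intro pigeonhole) simp
  then obtain i j where ij: "i < j" "j \<le> m" "?s i mod m = ?s j mod m"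
    by (force simp: inj_on_def linorder_neq_iff)
  define ys where "ys = drop i (take j xs)"
  have take_j: "take j xs = take i xs @ ys"
    using ij(1) append_take_drop_id[of i "take j xs"] by (simp add: ys_def min_def)
  then have "?s j = ?s i + sum_list (map g ys)"
    by simp
  then have "m dvd sum_list (map g ys)"
    using ij(3) by (metis add_diff_cancel_left' le_add1 mod_eq_dvd_iff_nat)
  moreover have "ys \<noteq> []"
    using ij assms(2) by (simp add: ys_def)
  moreover have "xs = take i xs @ ys @ drop j xs"
    using take_j append_take_drop_id[of j xs] by simp
  ultimately show ?thesis by blast
qed

lemma ex_list_with_counts:
  fixes z :: "nat \<Rightarrow> nat"
  shows "\<exists>xs. set xs \<subseteq> {..<k} \<and> (\<forall>i<k. count_list xs i = z i)"
proof (induction k)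
  case 0
  show ?case by (intro exI[of _ "[]"]) simp
next
  case (Suc k)
  then obtain xs where xs: "set xs \<subseteq> {..<k}" "\<forall>i<k. count_list xs i = z i" by blast
  have replicate: "count_list (replicate n k) i = (if i = k then n else 0)" for n i
    by (induction n) auto
  have "count_list xs k = 0"
    using xs(1) by (auto simp: count_list_0_iff)
  then have "\<forall>i<Suc k. count_list (xs @ replicate (z k) k) i = z i"
    using xs(2) by (auto simp: replicate less_Suc_eq)
  moreover have "set (xs @ replicate (z k) k) \<subseteq> {..<Suc k}"
    using xs(1) by (auto simp: less_Suc_eq)
  ultimately show ?case by blast
qed

text \<open>
  Listing every index as often as its multiplicity turns a vector into a sequence of summands,
  so that the statement about segments applies.
\<close>

lemma subvector_sum_dvd:
  fixes z g :: "nat \<Rightarrow> nat"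
  assumes "m > 0" "(\<Sum>i<k. z i) \<ge> m"
  shows "\<exists>b. (\<forall>i<k. b i \<le> z i) \<and> (\<exists>i<k. b i > 0) \<and> m dvd (\<Sum>i<k. b i * g i)"
proof -
  obtain xs where xs: "set xs \<subseteq> {..<k}" "\<forall>i<k. count_list xs i = z i"
    using ex_list_with_counts by blast
  have "length xs = (\<Sum>i<k. z i)"
    using sum_count_set[OF xs(1)] xs(2) by simp
  then obtain us ys vs where split: "xs = us @ ys @ vs" "ys \<noteq> []" "m dvd sum_list (map g ys)"
    using nonempty_segment_sum_dvd[of m xs g] assms by metis
  have "set ys \<subseteq> {..<k}" using xs(1) split(1) by auto
  then have "sum_list (map g ys) = (\<Sum>i<k. count_list ys i * g i)"
    by (intro sum_list_map_eq_sum_count2) auto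
  moreover have "\<forall>i<k. count_list ys i \<le> z i"
    using xs(2) split(1) by auto
  moreover have "hd ys < k" "count_list ys (hd ys) > 0"
    using \<open>set ys \<subseteq> {..<k}\<close> split(2) by (auto simp: subset_iff count_list_0_iff intro!: gr0I)
  ultimately show ?thesis
    using split(3) by (intro exI[of _ "count_list ys"]) auto
qed

section \<open>Exchanging summands for the best generator\<close>

lemma factorization_size_gt:
  assumes "z \<in> factorizations r n" "\<forall>i<length r. r ! i \<le> R" "n > R\<^sup>2"
  shows "(\<Sum>i<length r. z ! i) > R"
proof -
  have "R * R < n"
    using assms(3) by (simp add: power2_eq_square)
  also have "n = (\<Sum>i<length r. z ! i * r ! i)"
    using assms(1) by (simp add: factorizations_def)
  also have "\<dots> \<le> (\<Sum>i<length r. z ! i) * R"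
    using assms(2) by (auto simp: sum_distrib_right intro!: sum_mono)
  finally show ?thesis by simp
qed

text \<open>
  A subcollection of the summands with total \<open>c * r ! p\<close> is replaced by \<open>c\<close> copies of \<open>r ! p\<close>.
  Since \<open>p\<close> has the largest weight per unit and both sides have the same total, the removed
  weight is at most the added weight \<open>c * w ! p\<close>.
\<close>

lemma exchange_for_best_generator:
  assumes len: "length w = length r" and p: "p < length r"
    and pos: "\<forall>i<length r. r ! i > 0"
    and best: "\<forall>i<length r. w_le r w p i"
    and z: "z \<in> factorizations r n" and size: "(\<Sum>i<length r. z ! i) \<ge> r ! p"
  shows "\<exists>y\<in>factorizations r n. y ! p > 0 \<and> weighted_length w z \<le> weighted_length w y"
proof -
  let ?k = "length r"
  obtain b where b: "\<forall>i<?k. b i \<le> z ! i" "\<exists>i<?k. b i > 0" "r ! p dvd (\<Sum>i<?k. b i * r ! i)"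
    using subvector_sum_dvd[of "r ! p" "(!) z" "?k" "(!) r"] pos p size by auto
  then obtain c where c: "(\<Sum>i<?k. b i * r ! i) = r ! p * c" by (auto simp: dvd_def)
  obtain i where i: "i < ?k" "b i > 0" using b(2) by blast
  have "0 < b i * r ! i" using i pos by simp
  also have "\<dots> \<le> (\<Sum>i<?k. b i * r ! i)" using i by (intro member_le_sum) auto
  finally have "c > 0" using c by (auto intro: gr0I)
  define y where "y = map (\<lambda>i. z ! i - b i + (if i = p then c else 0)) [0..<?k]"
  have nth_y: "y ! i = z ! i - b i + (if i = p then c else 0)" if "i < ?k" for i
    using that by (simp add: y_def)
  have "(\<Sum>i<?k. y ! i * r ! i) + r ! p * c
        = (\<Sum>i<?k. (y ! i + b i) * r ! i)"
    unfolding c[symmetric] by (simp add: add_mult_distrib sum.distrib)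
  also have "\<dots> = (\<Sum>i<?k. z ! i * r ! i + (if i = p then r ! p * c else 0))"
  proof (intro sum.cong refl)
    fix i assume "i \<in> {..<?k}"
    then have "y ! i + b i = z ! i + (if i = p then c else 0)"
      using b(1)[rule_format, of i] by (simp add: nth_y)
    then show "(y ! i + b i) * r ! i = z ! i * r ! i + (if i = p then r ! p * c else 0)"
      by (auto simp: add_mult_distrib)
  qed
  also have "\<dots> = n + r ! p * c"
    using z p by (simp add: factorizations_def sum.distrib)
  finally have "y \<in> factorizations r n"
    by (simp add: factorizations_def y_def)
  moreover have "y ! p > 0" using p \<open>c > 0\<close> by (simp add: nth_y)
  moreover have "weighted_length w z \<le> weighted_length w y"
  proof -
    have removed: "(\<Sum>i<?k. w ! i * of_nat (b i)) \<le> w ! p * of_nat c"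
    proof -
      have "(\<Sum>i<?k. w ! i * of_nat (b i))
            \<le> (\<Sum>i<?k. w ! p / of_nat (r ! p) * of_nat (b i * r ! i))"
      proof (intro sum_mono)
        fix i assume "i \<in> {..<?k}"
        then have "r ! i > 0" "w ! i / of_nat (r ! i) \<le> w ! p / of_nat (r ! p)"
          using best pos by (auto simp: w_le_def)
        then have "w ! i \<le> w ! p / of_nat (r ! p) * of_nat (r ! i)"
          by (simp add: pos_divide_le_eq)
        from mult_right_mono[OF this, of "of_nat (b i)"]
        show "w ! i * of_nat (b i) \<le> w ! p / of_nat (r ! p) * of_nat (b i * r ! i)"
          by (simp add: mult_ac)
      qed
      also have "\<dots> = w ! p / of_nat (r ! p) * of_nat (r ! p * c)"
        unfolding c[symmetric] of_nat_sum by (simp add: sum_distrib_left)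
      also have "\<dots> = w ! p * of_nat c"
        using pos[rule_format, OF p] by simp
      finally show ?thesis .
    qed
    have "weighted_length w y
          = (\<Sum>i<?k. w ! i * of_nat (z ! i) - w ! i * of_nat (b i)
                       + (if i = p then w ! p * of_nat c else 0))"
      unfolding weighted_length_def len using b(1)
      by (intro sum.cong) (auto simp: nth_y of_nat_diff algebra_simps)
    also have "\<dots> = weighted_length w z - (\<Sum>i<?k. w ! i * of_nat (b i)) + w ! p * of_nat c"
      using p by (simp add: weighted_length_def len sum.distrib sum_subtractf)
    finally show ?thesis using removed by simp
  qed
  ultimately show ?thesis by blast
qed

section \<open>Changing a single multiplicity\<close>

lemma sum_nth_list_update:
  fixes a :: "nat \<Rightarrow> 'a::comm_ring_1"
  assumes "p < k" "length z = k"
  shows "(\<Sum>i<k. a i * of_nat (z[p := x] ! i)) =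
         (\<Sum>i<k. a i * of_nat (z ! i)) + a p * (of_nat x - of_nat (z ! p))"
proof -
  have "(\<Sum>i<k. a i * of_nat (z[p := x] ! i))
        = (\<Sum>i<k. a i * of_nat (z ! i) + (if i = p then a p * (of_nat x - of_nat (z ! p)) else 0))"
    using assms by (intro sum.cong) (auto simp: nth_list_update algebra_simps)
  then show ?thesis using assms by (simp add: sum.distrib)
qed

lemma weighted_length_update:
  assumes "p < length w" "length z = length w"
  shows "weighted_length w (z[p := x]) =
         weighted_length w z + w ! p * (of_nat x - of_nat (z ! p))"
  unfolding weighted_length_def using assms by (rule sum_nth_list_update)

lemma factorizations_update:
  assumes z: "z \<in> factorizations r n" and p: "p < length r"
    and eq: "n' + z ! p * r ! p = n + x * r ! p"
  shows "z[p := x] \<in> factorizations r n'"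
proof -
  have len: "length z = length r" and n: "n = (\<Sum>i<length r. z ! i * r ! i)"
    using z by (auto simp: factorizations_def)
  \<comment> \<open>Over the integers, the update formula applies with a difference that may be negative.\<close>
  have "int (\<Sum>i<length r. z[p := x] ! i * r ! i) = (\<Sum>i<length r. int (r ! i) * int (z[p := x] ! i))"
    by (simp add: mult.commute)
  also have "\<dots> = int n + int (r ! p) * (int x - int (z ! p))"
    using sum_nth_list_update[OF p len, of "\<lambda>i. int (r ! i)" x]
    by (simp add: n mult.commute)
  also have "\<dots> = int n'"
    using arg_cong[OF eq, of int] by (simp add: algebra_simps)
  finally have "n' = (\<Sum>i<length r. z[p := x] ! i * r ! i)"
    unfolding of_nat_eq_iff by (rule sym)
  then show ?thesis
    using len by (simp add: factorizations_def)
qed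

section \<open>Recursions for the extremal weighted lengths\<close>

text \<open>
  Inserting one copy of \<open>r ! p\<close> gives \<open>\<ge>\<close>; removing one from a maximal factorization that
  uses \<open>r ! p\<close>, which exists by the exchange, gives \<open>\<le>\<close> and shows that \<open>n - r ! p\<close> lies in
  the semigroup.
\<close>

lemma max_length_recursion:
  assumes len: "length w = length r" and p: "p < length r"
    and pos: "\<forall>i<length r. r ! i > 0"
    and best: "\<forall>i<length r. w_le r w p i"
    and n: "n \<in> num_semigroup r" "n > (Max (set r))\<^sup>2"
  shows "n - r ! p \<in> num_semigroup r \<and>
         max_length r w n = max_length r w (n - r ! p) + w ! p"
proof -
  have fin: "finite (length_set r w n')" for n'
    using pos by (intro finite_length_set) (auto simp: in_set_conv_nth)
  have le_R: "\<forall>i<length r. r ! i \<le> Max (set r)"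
    by simp
  have "max_length r w n \<in> length_set r w n"
    using fin n(1) unfolding max_length_def by (intro Max_in) (auto simp: length_set_nonempty_iff)
  then obtain z where z: "z \<in> factorizations r n" "weighted_length w z = max_length r w n"
    by (auto simp: length_set_def)
  have "(\<Sum>i<length r. z ! i) \<ge> r ! p"
    using factorization_size_gt[OF z(1) le_R n(2)] le_R p by (meson le_less_trans less_imp_le)
  then obtain y where y: "y \<in> factorizations r n" "y ! p > 0"
      "max_length r w n \<le> weighted_length w y"
    using exchange_for_best_generator[OF len p pos best z(1)] z(2) by auto
  have len_y: "length y = length w" using y(1) len by (simp add: factorizations_def)
  have "y ! p * r ! p \<le> n"
    using y(1) p member_le_sum[of p "{..<length r}" "\<lambda>i. y ! i * r ! i"]
    by (simp add: factorizations_def)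
  moreover have "r ! p \<le> y ! p * r ! p" using y(2) by simp
  ultimately have r_le: "r ! p \<le> n" by (rule order.trans[rotated])
  have "(n - r ! p) + y ! p * r ! p = n + (y ! p - 1) * r ! p"
    using r_le y(2) by (cases "y ! p") auto
  then have removed: "y[p := y ! p - 1] \<in> factorizations r (n - r ! p)"
    by (rule factorizations_update[OF y(1) p])
  then have nonempty: "length_set r w (n - r ! p) \<noteq> {}"
    by (auto simp: length_set_def)
  have "weighted_length w (y[p := y ! p - 1]) = weighted_length w y - w ! p"
    using p len y(2) by (simp add: weighted_length_update[OF _ len_y] of_nat_diff)
  moreover have "weighted_length w (y[p := y ! p - 1]) \<le> max_length r w (n - r ! p)"
    unfolding max_length_def using fin removed by (intro Max_ge) (auto simp: length_set_def)
  ultimately have upper: "max_length r w n \<le> max_length r w (n - r ! p) + w ! p"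
    using y(3) by simp
  have "max_length r w (n - r ! p) \<in> length_set r w (n - r ! p)"
    using fin nonempty unfolding max_length_def by (intro Max_in)
  then obtain x where x: "x \<in> factorizations r (n - r ! p)"
      "weighted_length w x = max_length r w (n - r ! p)"
    by (auto simp: length_set_def)
  have "n + x ! p * r ! p = (n - r ! p) + Suc (x ! p) * r ! p"
    using r_le by simp
  then have "x[p := Suc (x ! p)] \<in> factorizations r n"
    by (rule factorizations_update[OF x(1) p])
  then have "weighted_length w (x[p := Suc (x ! p)]) \<le> max_length r w n"
    unfolding max_length_def using fin by (intro Max_ge) (auto simp: length_set_def)
  moreover have "weighted_length w (x[p := Suc (x ! p)]) = weighted_length w x + w ! p"
    using p len x(1) by (subst weighted_length_update) (auto simp: factorizations_def)
  ultimately show ?thesis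
    using upper x(2) nonempty by (auto simp: length_set_nonempty_iff)
qed

lemma min_length_eq_neg_max_length:
  assumes "length w = length r" "\<forall>i<length r. r ! i > 0" "n \<in> num_semigroup r"
  shows "min_length r w n = - max_length r (map uminus w) n"
proof -
  have "weighted_length (map uminus w) z = - weighted_length w z" for z
    by (simp add: weighted_length_def sum_negf)
  then have "length_set r (map uminus w) n = uminus ` length_set r w n"
    by (auto simp: length_set_def)
  moreover have "finite (length_set r w n)"
    using assms(2) by (intro finite_length_set) (auto simp: in_set_conv_nth)
  moreover have "length_set r w n \<noteq> {}"
    using assms(3) by (simp add: length_set_nonempty_iff)
  ultimately show ?thesis
    by (simp add: max_length_def min_length_def image_image)
qed

theorem theorem3p7:
  fixes r :: "nat list" and w :: "rat list" and k R :: nat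
  assumes "length r = k" and "length w = k" and "k \<ge> 1"
    and "\<forall>i<k. r ! i > 0"
    and "\<forall>i j. i \<le> j \<and> j < k \<longrightarrow> w_le r w i j"
    and "R = Max (set r)"
  shows "(\<forall>n \<in> num_semigroup r. n > R\<^sup>2 \<longrightarrow>
            n - r ! 0 \<in> num_semigroup r \<and>
            max_length r w n = max_length r w (n - r ! 0) + w ! 0) \<and>
         (\<forall>n \<in> num_semigroup r. n > R\<^sup>2 \<longrightarrow>
            n - r ! (k - 1) \<in> num_semigroup r \<and>
            min_length r w n = min_length r w (n - r ! (k - 1)) + w ! (k - 1))"
proof (intro conjI ballI impI)
  fix n assume n: "n \<in> num_semigroup r" "n > R\<^sup>2"
  have first: "n - r ! 0 \<in> num_semigroup r \<and>
      max_length r w n = max_length r w (n - r ! 0) + w ! 0"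
    using assms n by (intro max_length_recursion) auto
  show "n - r ! 0 \<in> num_semigroup r" "max_length r w n = max_length r w (n - r ! 0) + w ! 0"
    using first by auto
  have "\<forall>i<length r. w_le r w i (k - 1)"
    using assms by auto
  then have "\<forall>i<length r. w_le r (map uminus w) (k - 1) i"
    using assms(1-3) by (simp add: w_le_def)
  then have last: "n - r ! (k - 1) \<in> num_semigroup r \<and>
      max_length r (map uminus w) n
        = max_length r (map uminus w) (n - r ! (k - 1)) + map uminus w ! (k - 1)"
    using assms n by (intro max_length_recursion) auto
  show "n - r ! (k - 1) \<in> num_semigroup r"
    using last by simp
  show "min_length r w n = min_length r w (n - r ! (k - 1)) + w ! (k - 1)"
    using last assms(1-4) n(1) by (simp add: min_length_eq_neg_max_length)
qed

end
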